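(* For every set of formulas $\Gamma\cup\{\varphi\}\subseteq\mathbf F(\Sigma_{\mathbf{bI}},\mathcal V)$: $\Gamma\vDash_{\mathbf{bI}}\varphi$ if and only if $\Gamma\vDash_{\mathcal M^{\mathbf 2}_{\mathbf{bI}}}\varphi$. Hence, $\Gamma\vdash_{\mathbf{bI}}\varphi$ if and only if $\Gamma\vDash_{\mathcal M^{\mathbf 2}_{\mathbf{bI}}}\varphi$.
   Context: Let $\mathcal V$ be a countable set of propositional variables and $\Sigma_{\mathbf{bI}}=\{\vee,\wedge,\rightarrow,\uparrow\}$, all connectives binary; $\mathbf F(\Sigma_{\mathbf{bI}},\mathcal V)$ is the set of formulas. The logic $\mathbf{bI}$ is the Hilbert calculus whose only inference rule is Modus Ponens and whose axioms are all instances (with arbitrary formulas) of: (1) $\alpha\to(\beta\to\alpha)$; (2) $(\alpha\to(\beta\to\gamma))\to((\alpha\to\beta)\to(\alpha\to\gamma))$; (3) $\alpha\to(\beta\to(\alpha\wedge\beta))$; (4) $(\alpha\wedge\beta)\to\alpha$; (5) $(\alpha\wedge\beta)\to\beta$; (6) $\alpha\to(\alpha\vee\beta)$; (7) $\beta\to(\alpha\vee\beta)$; (8) $(\alpha\to\gamma)\to((\beta\to\gamma)\to((\alpha\vee\beta)\to\gamma))$; (9) $(\alpha\to\beta)\vee\alpha$; (Ip) $(\alpha\uparrow\beta)\to(\alpha\to(\beta\to\gamma))$; (Comm) $(\alpha\uparrow\beta)\to(\beta\uparrow\alpha)$. $\Gamma\vdash_{\mathbf{bI}}\varphi$ means that there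 is a finite derivation of $\varphi$ from premises in $\Gamma$. A bivaluation for $\mathbf{bI}$ is a map $\nu:\mathbf F(\Sigma_{\mathbf{bI}},\mathcal V)\to\{0,1\}$ such that for all formulas $\alpha,\beta$: $\nu(\alpha\vee\beta)=1$ iff $\nu(\alpha)=1$ or $\nu(\beta)=1$; $\nu(\alpha\wedge\beta)=1$ iff $\nu(\alpha)=\nu(\beta)=1$; $\nu(\alpha\to\beta)=1$ iff $\nu(\alpha)=0$ or $\nu(\beta)=1$; if $\nu(\alpha\uparrow\beta)=1$ then $\nu(\alpha)=0$ or $\nu(\beta)=0$; $\nu(\alpha\uparrow\beta)=\nu(\beta\uparrow\alpha)$. $\Gamma\vDash_{\mathbf{bI}}\varphi$ means: for every bivaluation $\nu$ for $\mathbf{bI}$, if $\nu(\gamma)=1$ for all $\gamma\in\Gamma$ then $\nu(\varphi)=1$. Let $\mathbf 2_{\mathbf{bI}}$ be the multialgebra with universe $\{0,1\}$ in which $\vee,\wedge,\to$ are the usual (deterministic) Boolean operations and $\uparrow$ is the multioperation $1\uparrow1=\{0\}$, $x\uparrow y=\{0,1\}$ otherwise. A valuation over $\mathbf 2_{\mathbf{bI}}$ is a map $\nu:\mathbf F(\Sigma_{\mathbf{bI}},\mathcal V)\to\{0,1\}$ with $\nu(\alpha\#\beta)=\nu(\alpha)\#\nu(\beta)$ for $\#\in\{\vee,\wedge,\to\}$ and $\nu(\alpha\uparrow\beta)\in\nu(\alpha)\uparrow\nu(\beta)$. The restricted non-deterministic matrix $\mathcal M^{\mathbf 2}_{\mathbf{bI}}=(\mathbf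 2_{\mathbf{bI}},\{1\},\mathcal F_{\mathbf 2_{\mathbf{bI}}})$ has $\mathcal F_{\mathbf 2_{\mathbf{bI}}}$ equal to the set of all valuations $\nu$ over $\mathbf 2_{\mathbf{bI}}$ with $\nu(\alpha\uparrow\beta)=\nu(\beta\uparrow\alpha)$ for all formulas $\alpha,\beta$. $\Gamma\vDash_{\mathcal M^{\mathbf 2}_{\mathbf{bI}}}\varphi$ means: for every $\nu\in\mathcal F_{\mathbf 2_{\mathbf{bI}}}$, if $\nu(\gamma)=1$ for all $\gamma\in\Gamma$ then $\nu(\varphi)=1$. *)

theory Defs
  imports "HOL-Library.Countable"
begin

datatype 'v form =
    Var 'v
  | Or "'v form" "'v form"  (infixr \<open>\<^bold>\<or>\<close> 70)
  | And "'v form" "'v form"  (infixr \<open>\<^bold>\<and>\<close> 75)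
  | Imp "'v form" "'v form"  (infixr \<open>\<^bold>\<rightarrow>\<close> 65)
  | Up "'v form" "'v form"  (infixl \<open>\<^bold>\<up>\<close> 80)

inductive bI_axiom :: "'v form \<Rightarrow> bool" where
  Ax1: "bI_axiom (\<alpha> \<^bold>\<rightarrow> (\<beta> \<^bold>\<rightarrow> \<alpha>))"
| Ax2: "bI_axiom ((\<alpha> \<^bold>\<rightarrow> (\<beta> \<^bold>\<rightarrow> \<gamma>)) \<^bold>\<rightarrow> ((\<alpha> \<^bold>\<rightarrow> \<beta>) \<^bold>\<rightarrow> (\<alpha> \<^bold>\<rightarrow> \<gamma>)))"
| Ax3: "bI_axiom (\<alpha> \<^bold>\<rightarrow> (\<beta> \<^bold>\<rightarrow> (\<alpha> \<^bold>\<and> \<beta>)))"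
| Ax4: "bI_axiom ((\<alpha> \<^bold>\<and> \<beta>) \<^bold>\<rightarrow> \<alpha>)"
| Ax5: "bI_axiom ((\<alpha> \<^bold>\<and> \<beta>) \<^bold>\<rightarrow> \<beta>)"
| Ax6: "bI_axiom (\<alpha> \<^bold>\<rightarrow> (\<alpha> \<^bold>\<or> \<beta>))"
| Ax7: "bI_axiom (\<beta> \<^bold>\<rightarrow> (\<alpha> \<^bold>\<or> \<beta>))"
| Ax8: "bI_axiom ((\<alpha> \<^bold>\<rightarrow> \<gamma>) \<^bold>\<rightarrow> ((\<beta> \<^bold>\<rightarrow> \<gamma>) \<^bold>\<rightarrow> ((\<alpha> \<^bold>\<or> \<beta>) \<^bold>\<rightarrow> \<gamma>)))"
| Ax9: "bI_axiom ((\<alpha> \<^bold>\<rightarrow> \<beta>) \<^bold>\<or> \<alpha>)"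
| Ip: "bI_axiom ((\<alpha> \<^bold>\<up> \<beta>) \<^bold>\<rightarrow> (\<alpha> \<^bold>\<rightarrow> (\<beta> \<^bold>\<rightarrow> \<gamma>)))"
| Comm: "bI_axiom ((\<alpha> \<^bold>\<up> \<beta>) \<^bold>\<rightarrow> (\<beta> \<^bold>\<up> \<alpha>))"

definition bI_derivation :: "'v form set \<Rightarrow> 'v form list \<Rightarrow> bool" where
  "bI_derivation \<Gamma> ds \<longleftrightarrow>
     (\<forall>i < length ds. ds ! i \<in> \<Gamma> \<or> bI_axiom (ds ! i) \<or>
        (\<exists>j < i. \<exists>k < i. ds ! k = (ds ! j \<^bold>\<rightarrow> ds ! i)))"

definition bI_derivable :: "'v form set \<Rightarrow> 'v form \<Rightarrow> bool"  (infix \<open>\<turnstile>\<^sub>b\<^sub>I\<close> 50) where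
  "\<Gamma> \<turnstile>\<^sub>b\<^sub>I \<phi> \<longleftrightarrow> (\<exists>ds. bI_derivation \<Gamma> ds \<and> ds \<noteq> [] \<and> last ds = \<phi>)"

text \<open>The truth values 0 and 1 are represented by \<^const>\<open>False\<close> and \<^const>\<open>True\<close>.\<close>

definition bI_bivaluation :: "('v form \<Rightarrow> bool) \<Rightarrow> bool" where
  "bI_bivaluation \<nu> \<longleftrightarrow> (\<forall>\<alpha> \<beta>.
     (\<nu> (\<alpha> \<^bold>\<or> \<beta>) \<longleftrightarrow> \<nu> \<alpha> \<or> \<nu> \<beta>) \<and>
     (\<nu> (\<alpha> \<^bold>\<and> \<beta>) \<longleftrightarrow> \<nu> \<alpha> \<and> \<nu> \<beta>) \<and>
     (\<nu> (\<alpha> \<^bold>\<rightarrow> \<beta>) \<longleftrightarrow> \<not> \<nu> \<alpha> \<or> \<nu> \<beta>) \<and>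
     (\<nu> (\<alpha> \<^bold>\<up> \<beta>) \<longrightarrow> \<not> \<nu> \<alpha> \<or> \<not> \<nu> \<beta>) \<and>
     (\<nu> (\<alpha> \<^bold>\<up> \<beta>) = \<nu> (\<beta> \<^bold>\<up> \<alpha>)))"

definition bI_entails :: "'v form set \<Rightarrow> 'v form \<Rightarrow> bool"  (infix \<open>\<Turnstile>\<^sub>b\<^sub>I\<close> 50) where
  "\<Gamma> \<Turnstile>\<^sub>b\<^sub>I \<phi> \<longleftrightarrow> (\<forall>\<nu>. bI_bivaluation \<nu> \<longrightarrow> (\<forall>\<gamma>\<in>\<Gamma>. \<nu> \<gamma>) \<longrightarrow> \<nu> \<phi>)"

text \<open>Operations of a multialgebra are set-valued; a deterministic operation is one whose values
  are singletons, for which the membership condition on valuations is the usual homomorphism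
  equation.\<close>

record 'a multialgebra =
  universe :: "'a set"
  or_op :: "'a \<Rightarrow> 'a \<Rightarrow> 'a set"
  and_op :: "'a \<Rightarrow> 'a \<Rightarrow> 'a set"
  imp_op :: "'a \<Rightarrow> 'a \<Rightarrow> 'a set"
  up_op :: "'a \<Rightarrow> 'a \<Rightarrow> 'a set"

definition valuations :: "'a multialgebra \<Rightarrow> ('v form \<Rightarrow> 'a) set" where
  "valuations A = {\<nu>. range \<nu> \<subseteq> universe A \<and> (\<forall>\<alpha> \<beta>.
     \<nu> (\<alpha> \<^bold>\<or> \<beta>) \<in> or_op A (\<nu> \<alpha>) (\<nu> \<beta>) \<and>
     \<nu> (\<alpha> \<^bold>\<and> \<beta>) \<in> and_op A (\<nu> \<alpha>) (\<nu> \<beta>) \<and>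
     \<nu> (\<alpha> \<^bold>\<rightarrow> \<beta>) \<in> imp_op A (\<nu> \<alpha>) (\<nu> \<beta>) \<and>
     \<nu> (\<alpha> \<^bold>\<up> \<beta>) \<in> up_op A (\<nu> \<alpha>) (\<nu> \<beta>))}"

record ('a, 'v) rnmatrix =
  algebra :: "'a multialgebra"
  designated :: "'a set"
  admissible :: "('v form \<Rightarrow> 'a) set"

definition rnm_entails :: "'v form set \<Rightarrow> ('a, 'v) rnmatrix \<Rightarrow> 'v form \<Rightarrow> bool"
    (\<open>(_ \<Turnstile>\<^bsub>_\<^esub> _)\<close> [51, 0, 51] 50) where
  "\<Gamma> \<Turnstile>\<^bsub>M\<^esub> \<phi> \<longleftrightarrow>
     (\<forall>\<nu> \<in> admissible M. (\<forall>\<gamma>\<in>\<Gamma>. \<nu> \<gamma> \<in> designated M) \<longrightarrow> \<nu> \<phi> \<in> designated M)"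

definition two_bI :: "bool multialgebra" where
  "two_bI = \<lparr>
     universe = {False, True},
     or_op = (\<lambda>x y. {x \<or> y}),
     and_op = (\<lambda>x y. {x \<and> y}),
     imp_op = (\<lambda>x y. {x \<longrightarrow> y}),
     up_op = (\<lambda>x y. if x = True \<and> y = True then {False} else {False, True})\<rparr>"

definition F_two_bI :: "('v form \<Rightarrow> bool) set" where
  "F_two_bI = {\<nu> \<in> valuations two_bI. \<forall>\<alpha> \<beta>. \<nu> (\<alpha> \<^bold>\<up> \<beta>) = \<nu> (\<beta> \<^bold>\<up> \<alpha>)}"

definition M_two_bI :: "(bool, 'v) rnmatrix" where
  "M_two_bI = \<lparr>algebra = two_bI, designated = {True}, admissible = F_two_bI\<rparr>"

end

theory Submission
  imports Defs
begin

text \<open>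
  The equivalence of the two semantics is immediate once the conditions on valuations are read off
  the multioperations: a singleton value is an equation, and the two cases for \<open>\<alpha>
  \<^bold>\<up> \<beta>\<close> say precisely that it is false when both arguments are true and
  unconstrained otherwise. So the admissible valuations are the bivaluations
  (\<open>F_two_bI_eq_bivaluations\<close>), and all that remains is soundness and completeness of
  the calculus for bivaluations.

  Completeness is a Lindenbaum argument. As modus ponens is the only rule and \<open>Ax1\<close> and
  \<open>Ax2\<close> are present, the deduction theorem holds. There is no negation to work with, so
  instead of maximal consistent sets one takes sets that are maximal among those not deriving the
  given formula \<open>\<phi>\<close>. By the deduction theorem, a formula outside such a set
  \<open>\<Delta>\<close> is exactly one that \<open>\<Delta>\<close> proves to imply
  \<open>\<phi>\<close>. Disjunction elimination (\<open>Ax8\<close>) then makes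
  \<open>\<Delta>\<close> prime, and primeness with the law \<open>(\<alpha> \<^bold>\<rightarrow>
  \<beta>) \<^bold>\<or> \<alpha>\<close> gives the classical truth condition of implication. Axiom
  \<open>Ip\<close> stops \<open>\<alpha> \<^bold>\<up> \<beta>\<close>, \<open>\<alpha>\<close> and
  \<open>\<beta>\<close> from lying in \<open>\<Delta>\<close> together, since \<open>\<phi>\<close>
  would follow; \<open>Comm\<close> is the symmetry of \<open>\<^bold>\<up>\<close>. Hence the
  characteristic function of \<open>\<Delta>\<close> is a bivaluation refuting \<open>\<phi>\<close>
  (\<open>bivaluation_of_saturated\<close>).
\<close>


section \<open>Bivaluations as admissible valuations\<close>

lemma F_two_bI_eq_bivaluations: "F_two_bI = {\<nu>. bI_bivaluation \<nu>}"
proof -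
  have "\<nu> \<in> F_two_bI \<longleftrightarrow> bI_bivaluation \<nu>" for \<nu> :: "'v form \<Rightarrow> bool"
    unfolding F_two_bI_def valuations_def two_bI_def bI_bivaluation_def by auto
  then show ?thesis by blast
qed

lemma bI_entails_iff_rnm_entails: "\<Gamma> \<Turnstile>\<^sub>b\<^sub>I \<phi> \<longleftrightarrow> \<Gamma> \<Turnstile>\<^bsub>M_two_bI\<^esub> \<phi>"
  by (simp add: bI_entails_def rnm_entails_def M_two_bI_def F_two_bI_eq_bivaluations)


section \<open>Derivability as an inductive predicate\<close>

text \<open>Induction on derivations is smoother over theoremhood generated by the rules than over lists
  with index conditions.\<close>

inductive proves :: "'v form set \<Rightarrow> 'v form \<Rightarrow> bool" for \<Gamma> where
  premise: "\<phi> \<in> \<Gamma> \<Longrightarrow> proves \<Gamma> \<phi>"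
| "axiom": "bI_axiom \<phi> \<Longrightarrow> proves \<Gamma> \<phi>"
| mp: "proves \<Gamma> (\<phi> \<^bold>\<rightarrow> \<psi>) \<Longrightarrow> proves \<Gamma> \<phi> \<Longrightarrow> proves \<Gamma> \<psi>"

lemma bI_derivation_append:
  assumes "bI_derivation \<Gamma> ds" and "bI_derivation \<Gamma> es"
  shows "bI_derivation \<Gamma> (ds @ es)"
  unfolding bI_derivation_def
proof (intro allI impI)
  let ?n = "length ds"
  fix i assume i: "i < length (ds @ es)"
  show "(ds @ es) ! i \<in> \<Gamma> \<or> bI_axiom ((ds @ es) ! i) \<or>
    (\<exists>j<i. \<exists>k<i. (ds @ es) ! k = ((ds @ es) ! j \<^bold>\<rightarrow> (ds @ es) ! i))"
  proof (cases "i < ?n")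
    case True
    have "(ds @ es) ! j = ds ! j" if "j \<le> i" for j
      using that True by (simp add: nth_append)
    then show ?thesis
      using assms(1) True unfolding bI_derivation_def
      by (metis less_imp_le order_refl)
  next
    case False
    define m where "m = i - ?n"
    have im: "i = ?n + m" and m: "m < length es"
      using False i by (auto simp: m_def)
    have shift: "(ds @ es) ! (?n + j) = es ! j" for j
      by (simp add: nth_append)
    from assms(2) m consider "es ! m \<in> \<Gamma> \<or> bI_axiom (es ! m)"
      | j k where "j < m" "k < m" "es ! k = (es ! j \<^bold>\<rightarrow> es ! m)"
      unfolding bI_derivation_def by blast
    then show ?thesis
    proof cases
      case 1
      then show ?thesis by (simp only: im shift) blast
    next
      case 2
      then have "?n + j < i" "?n + k < i"
        "(ds @ es) ! (?n + k) = ((ds @ es) ! (?n + j) \<^bold>\<rightarrow> (ds @ es) ! i)"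
        by (simp_all only: im shift add_less_cancel_left)
      then show ?thesis by blast
    qed
  qed
qed

lemma bI_derivation_snoc:
  assumes ds: "bI_derivation \<Gamma> ds" and "\<psi> \<in> set ds" and "(\<psi> \<^bold>\<rightarrow> \<phi>) \<in> set ds"
  shows "bI_derivation \<Gamma> (ds @ [\<phi>])"
proof -
  from assms obtain j k where jk: "j < length ds" "ds ! j = \<psi>" "k < length ds" "ds ! k = (\<psi> \<^bold>\<rightarrow> \<phi>)"
    by (auto simp: in_set_conv_nth)
  show ?thesis
    unfolding bI_derivation_def
  proof (intro allI impI)
    fix i assume "i < length (ds @ [\<phi>])"
    then consider "i < length ds" | "i = length ds" by fastforce
    then show "(ds @ [\<phi>]) ! i \<in> \<Gamma> \<or> bI_axiom ((ds @ [\<phi>]) ! i) \<or>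
      (\<exists>j<i. \<exists>k<i. (ds @ [\<phi>]) ! k = ((ds @ [\<phi>]) ! j \<^bold>\<rightarrow> (ds @ [\<phi>]) ! i))"
    proof cases
      case 1
      have "(ds @ [\<phi>]) ! j = ds ! j" if "j \<le> i" for j
        using that 1 by (simp add: nth_append)
      then show ?thesis
        using ds 1 unfolding bI_derivation_def by (metis less_imp_le order_refl)
    next
      case 2
      then show ?thesis using jk by (auto simp: nth_append)
    qed
  qed
qed

lemma bI_derivable_iff_proves: "\<Gamma> \<turnstile>\<^sub>b\<^sub>I \<phi> \<longleftrightarrow> proves \<Gamma> \<phi>"
proof
  assume "\<Gamma> \<turnstile>\<^sub>b\<^sub>I \<phi>"
  then obtain ds where ds: "bI_derivation \<Gamma> ds" "ds \<noteq> []" "last ds = \<phi>"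
    unfolding bI_derivable_def by blast
  have "proves \<Gamma> (ds ! i)" if "i < length ds" for i
    using that
  proof (induction i rule: less_induct)
    case (less i)
    have IH: "proves \<Gamma> (ds ! j)" if "j < i" for j
      using less that by simp
    from ds(1) less.prems consider "ds ! i \<in> \<Gamma>" | "bI_axiom (ds ! i)"
      | j k where "j < i" "k < i" "ds ! k = (ds ! j \<^bold>\<rightarrow> ds ! i)"
      unfolding bI_derivation_def by blast
    then show ?case
    proof cases
      case (3 j k)
      then show ?thesis using IH[of j] IH[of k] by (auto intro: proves.mp)
    qed (auto intro: proves.premise proves.axiom)
  qed
  then show "proves \<Gamma> \<phi>"
    using ds(2,3) by (metis diff_less last_conv_nth length_greater_0_conv zero_less_one)
next
  assume "proves \<Gamma> \<phi>"
  then show "\<Gamma> \<turnstile>\<^sub>b\<^sub>I \<phi>"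
  proof induction
    case (premise \<phi>)
    then have "bI_derivation \<Gamma> [\<phi>]" by (simp add: bI_derivation_def)
    then show ?case unfolding bI_derivable_def by force
  next
    case ("axiom" \<phi>)
    then have "bI_derivation \<Gamma> [\<phi>]" by (simp add: bI_derivation_def)
    then show ?case unfolding bI_derivable_def by force
  next
    case (mp \<phi> \<psi>)
    then obtain ds es where ds: "bI_derivation \<Gamma> ds" "ds \<noteq> []" "last ds = (\<phi> \<^bold>\<rightarrow> \<psi>)"
      and es: "bI_derivation \<Gamma> es" "es \<noteq> []" "last es = \<phi>"
      unfolding bI_derivable_def by blast
    have "\<phi> \<in> set (ds @ es)" "(\<phi> \<^bold>\<rightarrow> \<psi>) \<in> set (ds @ es)"
      using ds es by (auto dest: last_in_set)
    then have "bI_derivation \<Gamma> ((ds @ es) @ [\<psi>])"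
      by (intro bI_derivation_snoc bI_derivation_append ds es)
    then show ?case unfolding bI_derivable_def by force
  qed
qed

lemma proves_mono: "proves \<Gamma> \<phi> \<Longrightarrow> \<Gamma> \<subseteq> \<Delta> \<Longrightarrow> proves \<Delta> \<phi>"
  by (induction rule: proves.induct) (auto intro: proves.intros)

lemma proves_finite_support:
  "proves \<Gamma> \<phi> \<Longrightarrow> \<exists>\<Gamma>'. finite \<Gamma>' \<and> \<Gamma>' \<subseteq> \<Gamma> \<and> proves \<Gamma>' \<phi>"
proof (induction rule: proves.induct)
  case (premise \<phi>)
  then show ?case by (intro exI[of _ "{\<phi>}"]) (simp add: proves.premise)
next
  case ("axiom" \<phi>)
  then show ?case by (intro exI[of _ "{}"]) (simp add: proves.axiom)
next
  case (mp \<phi> \<psi>)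
  then obtain A B where "finite A" "A \<subseteq> \<Gamma>" "proves A (\<phi> \<^bold>\<rightarrow> \<psi>)" "finite B" "B \<subseteq> \<Gamma>" "proves B \<phi>"
    by blast
  then show ?case
    by (intro exI[of _ "A \<union> B"]) (auto intro: proves.mp proves_mono)
qed

lemma deduction_theorem:
  "proves (insert \<alpha> \<Gamma>) \<beta> \<Longrightarrow> proves \<Gamma> (\<alpha> \<^bold>\<rightarrow> \<beta>)"
proof (induction rule: proves.induct)
  case (premise \<beta>)
  \<comment> \<open>the combinator identity \<open>S K K = I\<close>\<close>
  have "proves \<Gamma> (\<alpha> \<^bold>\<rightarrow> \<alpha>)"
    by (rule proves.mp[OF proves.mp[OF proves.axiom[OF Ax2] proves.axiom[OF Ax1]]
          proves.axiom[OF Ax1[of \<alpha> \<alpha>]]])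
  moreover have "proves \<Gamma> (\<alpha> \<^bold>\<rightarrow> \<beta>)" if "\<beta> \<in> \<Gamma>"
    by (rule proves.mp[OF proves.axiom[OF Ax1] proves.premise[OF that]])
  ultimately show ?case using premise by blast
next
  case ("axiom" \<beta>)
  show ?case by (rule proves.mp[OF proves.axiom[OF Ax1] proves.axiom[OF "axiom"]])
next
  case (mp \<beta> \<gamma>)
  show ?case by (rule proves.mp[OF proves.mp[OF proves.axiom[OF Ax2] mp.IH(1)] mp.IH(2)])
qed


section \<open>Soundness\<close>

lemma bI_axiom_valid: "bI_axiom \<phi> \<Longrightarrow> bI_bivaluation \<nu> \<Longrightarrow> \<nu> \<phi>"
  by (induction rule: bI_axiom.induct) (auto simp: bI_bivaluation_def)

lemma soundness:
  assumes "proves \<Gamma> \<phi>"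
  shows "\<Gamma> \<Turnstile>\<^sub>b\<^sub>I \<phi>"
  unfolding bI_entails_def
proof (intro allI impI)
  fix \<nu> :: "'a form \<Rightarrow> bool"
  assume \<nu>: "bI_bivaluation \<nu>" and \<Gamma>: "\<forall>\<gamma>\<in>\<Gamma>. \<nu> \<gamma>"
  from assms show "\<nu> \<phi>"
  proof induction
    case (mp \<phi> \<psi>)
    then show ?case using \<nu> by (simp add: bI_bivaluation_def)
  qed (use \<Gamma> \<nu> in \<open>auto intro: bI_axiom_valid\<close>)
qed


section \<open>Saturated sets and completeness\<close>

definition saturated :: "'v form \<Rightarrow> 'v form set \<Rightarrow> bool" where
  "saturated \<phi> \<Delta> \<longleftrightarrow> \<not> proves \<Delta> \<phi> \<and> (\<forall>\<alpha>. \<alpha> \<notin> \<Delta> \<longrightarrow> proves (insert \<alpha> \<Delta>) \<phi>)"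

text \<open>Zorn's lemma applies because a derivation uses finitely many premises, which a chain of sets
  has together in one of its members.\<close>

lemma saturated_extension:
  assumes "\<not> proves \<Gamma> \<phi>"
  obtains \<Delta> where "\<Gamma> \<subseteq> \<Delta>" and "saturated \<phi> \<Delta>"
proof -
  let ?C = "{\<Delta>. \<Gamma> \<subseteq> \<Delta> \<and> \<not> proves \<Delta> \<phi>}"
  have "\<exists>M\<in>?C. \<forall>X\<in>?C. M \<subseteq> X \<longrightarrow> X = M"
  proof (rule subset_Zorn_nonempty)
    show "?C \<noteq> {}" using assms by blast
  next
    fix \<C> assume ne: "\<C> \<noteq> {}" and chain: "subset.chain ?C \<C>"
    have "\<not> proves (\<Union>\<C>) \<phi>"
    proof
      assume "proves (\<Union>\<C>) \<phi>"
      then obtain F where F: "finite F" "F \<subseteq> \<Union>\<C>" "proves F \<phi>"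
        using proves_finite_support by blast
      obtain \<Delta> where "\<Delta> \<in> \<C>" "F \<subseteq> \<Delta>"
        using finite_subset_Union_chain[OF F(1,2) ne chain] by blast
      moreover from this F(3) have "proves \<Delta> \<phi>"
        using proves_mono by blast
      ultimately show False
        using chain unfolding subset.chain_def by blast
    qed
    moreover have "\<Gamma> \<subseteq> \<Union>\<C>"
      using ne chain unfolding subset.chain_def by blast
    ultimately show "\<Union>\<C> \<in> ?C" by blast
  qed
  then obtain \<Delta> where "\<Delta> \<in> ?C" and max: "\<forall>X\<in>?C. \<Delta> \<subseteq> X \<longrightarrow> X = \<Delta>"
    by (rule bexE)
  then have \<Delta>: "\<Gamma> \<subseteq> \<Delta>" "\<not> proves \<Delta> \<phi>" by simp_all
  have "proves (insert \<alpha> \<Delta>) \<phi>" if "\<alpha> \<notin> \<Delta>" for \<alpha>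
    using max[rule_format, of "insert \<alpha> \<Delta>"] \<Delta>(1) that by auto
  with \<Delta> that show thesis unfolding saturated_def by blast
qed

lemma not_mem_saturated_iff:
  assumes "saturated \<phi> \<Delta>"
  shows "\<alpha> \<notin> \<Delta> \<longleftrightarrow> proves \<Delta> (\<alpha> \<^bold>\<rightarrow> \<phi>)"
  using assms deduction_theorem[of \<alpha> \<Delta> \<phi>] proves.mp[of \<Delta> \<alpha> \<phi>] proves.premise[of \<alpha> \<Delta>]
  unfolding saturated_def by blast

lemma saturated_closed:
  assumes "saturated \<phi> \<Delta>"
  shows "proves \<Delta> \<alpha> \<longleftrightarrow> \<alpha> \<in> \<Delta>"
  using assms not_mem_saturated_iff[OF assms, of \<alpha>] proves.mp[of \<Delta> \<alpha> \<phi>] proves.premise[of \<alpha> \<Delta>]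
  unfolding saturated_def by blast

text \<open>If neither disjunct were in \<open>\<Delta>\<close>, both would imply \<open>\<phi>\<close>, and hence so would the
  disjunction.\<close>

lemma saturated_Or:
  assumes sat: "saturated \<phi> \<Delta>"
  shows "(\<alpha> \<^bold>\<or> \<beta>) \<in> \<Delta> \<longleftrightarrow> \<alpha> \<in> \<Delta> \<or> \<beta> \<in> \<Delta>"
proof
  assume "(\<alpha> \<^bold>\<or> \<beta>) \<in> \<Delta>"
  moreover have "(\<alpha> \<^bold>\<or> \<beta>) \<notin> \<Delta>" if "\<alpha> \<notin> \<Delta>" "\<beta> \<notin> \<Delta>"
    using that unfolding not_mem_saturated_iff[OF sat]
    by (rule proves.mp[OF proves.mp[OF proves.axiom[OF Ax8]]])
  ultimately show "\<alpha> \<in> \<Delta> \<or> \<beta> \<in> \<Delta>" by blast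
next
  assume "\<alpha> \<in> \<Delta> \<or> \<beta> \<in> \<Delta>"
  then show "(\<alpha> \<^bold>\<or> \<beta>) \<in> \<Delta>"
    unfolding saturated_closed[OF sat, symmetric]
    using proves.mp[OF proves.axiom[OF Ax6]] proves.mp[OF proves.axiom[OF Ax7]] by blast
qed

text \<open>When \<open>\<alpha>\<close> is not in \<open>\<Delta>\<close>, primeness applied to \<open>(\<alpha> \<^bold>\<rightarrow> \<beta>) \<^bold>\<or> \<alpha>\<close> leaves only \<open>\<alpha> \<^bold>\<rightarrow> \<beta>\<close>.
  This is the one place where classical strength is needed.\<close>

lemma saturated_Imp:
  assumes sat: "saturated \<phi> \<Delta>"
  shows "(\<alpha> \<^bold>\<rightarrow> \<beta>) \<in> \<Delta> \<longleftrightarrow> \<alpha> \<notin> \<Delta> \<or> \<beta> \<in> \<Delta>"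
proof -
  have "((\<alpha> \<^bold>\<rightarrow> \<beta>) \<^bold>\<or> \<alpha>) \<in> \<Delta>"
    using saturated_closed[OF sat] Ax9 proves.axiom by blast
  then have "(\<alpha> \<^bold>\<rightarrow> \<beta>) \<in> \<Delta> \<or> \<alpha> \<in> \<Delta>"
    unfolding saturated_Or[OF sat] .
  moreover have "\<beta> \<in> \<Delta> \<Longrightarrow> (\<alpha> \<^bold>\<rightarrow> \<beta>) \<in> \<Delta>"
    unfolding saturated_closed[OF sat, symmetric] by (rule proves.mp[OF proves.axiom[OF Ax1]])
  moreover have "(\<alpha> \<^bold>\<rightarrow> \<beta>) \<in> \<Delta> \<Longrightarrow> \<alpha> \<in> \<Delta> \<Longrightarrow> \<beta> \<in> \<Delta>"
    unfolding saturated_closed[OF sat, symmetric] by (rule proves.mp)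
  ultimately show ?thesis by blast
qed

lemma bivaluation_of_saturated:
  assumes sat: "saturated \<phi> \<Delta>"
  shows "bI_bivaluation (\<lambda>\<alpha>. \<alpha> \<in> \<Delta>)"
proof -
  note closed = saturated_closed[OF sat, symmetric]
  have And: "(\<alpha> \<^bold>\<and> \<beta>) \<in> \<Delta> \<longleftrightarrow> \<alpha> \<in> \<Delta> \<and> \<beta> \<in> \<Delta>" for \<alpha> \<beta>
    unfolding closed
    using proves.mp[OF proves.mp[OF proves.axiom[OF Ax3]]]
      proves.mp[OF proves.axiom[OF Ax4]] proves.mp[OF proves.axiom[OF Ax5]] by blast
  have Up: "\<alpha> \<notin> \<Delta> \<or> \<beta> \<notin> \<Delta>" if "(\<alpha> \<^bold>\<up> \<beta>) \<in> \<Delta>" for \<alpha> \<beta>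
  proof (rule ccontr)
    assume "\<not> (\<alpha> \<notin> \<Delta> \<or> \<beta> \<notin> \<Delta>)"
    then have "\<alpha> \<in> \<Delta>" "\<beta> \<in> \<Delta>" by auto
    then have "proves \<Delta> \<phi>"
      using proves.mp[OF proves.mp[OF proves.mp[OF proves.axiom[OF Ip]]]] that proves.premise
      by blast
    then show False using sat by (simp add: saturated_def)
  qed
  have Comm: "(\<beta> \<^bold>\<up> \<alpha>) \<in> \<Delta>" if "(\<alpha> \<^bold>\<up> \<beta>) \<in> \<Delta>" for \<alpha> \<beta>
    using that unfolding closed by (rule proves.mp[OF proves.axiom[OF bI_axiom.Comm]])
  show ?thesis
    unfolding bI_bivaluation_def
    by (intro allI conjI impI iffI[OF Comm Comm] saturated_Or[OF sat] saturated_Imp[OF sat] And Up)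
qed

lemma completeness:
  assumes "\<Gamma> \<Turnstile>\<^sub>b\<^sub>I \<phi>"
  shows "proves \<Gamma> \<phi>"
proof (rule ccontr)
  assume "\<not> proves \<Gamma> \<phi>"
  then obtain \<Delta> where \<Delta>: "\<Gamma> \<subseteq> \<Delta>" "saturated \<phi> \<Delta>"
    by (rule saturated_extension)
  then have "\<phi> \<in> \<Delta>"
    using assms bivaluation_of_saturated[OF \<Delta>(2)] unfolding bI_entails_def by blast
  then show False
    using \<Delta>(2) unfolding saturated_def by (blast intro: proves.premise)
qed


section \<open>Adequacy of the two-valued restricted non-deterministic matrix\<close>

theorem corollary1:
  fixes \<Gamma> :: "('v::countable) form set" and \<phi> :: "'v form"
  shows "(\<Gamma> \<Turnstile>\<^sub>b\<^sub>I \<phi> \<longleftrightarrow> \<Gamma> \<Turnstile>\<^bsub>M_two_bI\<^esub> \<phi>) \<and> (\<Gamma> \<turnstile>\<^sub>b\<^sub>I \<phi> \<longleftrightarrow> \<Gamma> \<Turnstile>\<^bsub>M_two_bI\<^esub> \<phi>)"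
proof
  show "\<Gamma> \<Turnstile>\<^sub>b\<^sub>I \<phi> \<longleftrightarrow> \<Gamma> \<Turnstile>\<^bsub>M_two_bI\<^esub> \<phi>"
    by (rule bI_entails_iff_rnm_entails)
  have "\<Gamma> \<turnstile>\<^sub>b\<^sub>I \<phi> \<longleftrightarrow> \<Gamma> \<Turnstile>\<^sub>b\<^sub>I \<phi>"
    unfolding bI_derivable_iff_proves by (rule iffI[OF soundness completeness])
  then show "\<Gamma> \<turnstile>\<^sub>b\<^sub>I \<phi> \<longleftrightarrow> \<Gamma> \<Turnstile>\<^bsub>M_two_bI\<^esub> \<phi>"
    unfolding bI_entails_iff_rnm_entails .
qed

end
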